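(* A set-graph has no Pythagorean holes; that is, for every $n\ge 2$, the set-graph $G_{A^{(n)}}$ contains no Pythagorean hole.
   Context: For a set $A^{(n)}=\{a_1,\dots,a_n\}$ of $n$ distinct elements, the set-graph $G_{A^{(n)}}$ is the simple undirected graph whose vertices correspond bijectively to the non-empty subsets of $A^{(n)}$, two distinct vertices being adjacent if and only if the corresponding subsets have non-empty intersection. (Singleton sets, giving the trivial graph, are excluded, so $n\ge 2$.) A primitive hole of a graph $G$ is a cycle of length $3$ in $G$. A Pythagorean hole of $G$ is a primitive hole whose three vertices can be labelled $v_i,v_j,v_k$ so that $d_G(v_i)^2+d_G(v_j)^2=d_G(v_k)^2$. *)

theory Defs
  imports "Graph_Theory.Graph_Theory"
begin

text \<open>Undirected simple graphs are rendered as in the library: finite, loop-free, symmetric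
  digraphs without parallel arcs (\<^locale>\<open>pair_graph\<close>). An edge \<open>uv\<close> is the
  pair of arcs \<open>(u, v)\<close>, \<open>(v, u)\<close>, so the number of arcs leaving a vertex is its
  number of neighbours.\<close>

definition degree :: "'v pair_pre_digraph \<Rightarrow> 'v \<Rightarrow> nat" where
  "degree G v = out_degree (with_proj G) v"

text \<open>The set-graph of \<open>A\<close> is determined only up to isomorphism, because its vertices merely
  correspond to the non-empty subsets of \<open>A\<close>; hence a predicate on graphs with vertices of
  an arbitrary type.\<close>

definition is_set_graph :: "'a set \<Rightarrow> 'v pair_pre_digraph \<Rightarrow> bool" where
  "is_set_graph A G \<longleftrightarrow> pair_graph G \<and>
     (\<exists>S. bij_betw S (pverts G) {X. X \<subseteq> A \<and> X \<noteq> {}} \<and>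
          (\<forall>u \<in> pverts G. \<forall>v \<in> pverts G.
             (u, v) \<in> parcs G \<longleftrightarrow> u \<noteq> v \<and> S u \<inter> S v \<noteq> {}))"

lemma is_set_graph_exists:
  assumes "finite A"
  shows "is_set_graph A \<lparr> pverts = {X. X \<subseteq> A \<and> X \<noteq> {}},
    parcs = {(X, Y). X \<subseteq> A \<and> Y \<subseteq> A \<and> X \<noteq> Y \<and> X \<inter> Y \<noteq> {}} \<rparr>"
    (is "is_set_graph A ?G")
proof -
  have "parcs ?G \<subseteq> Pow A \<times> Pow A" by auto
  then have "finite (parcs ?G)"
    by (rule finite_subset) (use assms in simp)
  moreover have "sym (parcs ?G)" by (auto intro!: symI)
  ultimately have "pair_graph ?G"
    using assms by unfold_locales (auto simp: symmetric_def)
  then show ?thesis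
    unfolding is_set_graph_def by (intro conjI exI[of _ "\<lambda>X. X"]) (auto simp: bij_betw_def)
qed

text \<open>A cycle is given by its list of arcs, i.e. with a starting vertex and an orientation.
  The 2-cycles \<open>u, v, u\<close> of the symmetric digraph, which are not cycles of the
  undirected graph, are excluded by the length.\<close>

definition primitive_hole :: "'v pair_pre_digraph \<Rightarrow> ('v \<times> 'v) awalk \<Rightarrow> bool" where
  "primitive_hole G c \<longleftrightarrow> pre_digraph.cycle (with_proj G) c \<and> length c = 3"

definition pythagorean_hole :: "'v pair_pre_digraph \<Rightarrow> ('v \<times> 'v) awalk \<Rightarrow> bool" where
  "pythagorean_hole G c \<longleftrightarrow> primitive_hole G c \<and>
     (\<exists>vi vj vk. distinct [vi, vj, vk] \<and> {vi, vj, vk} = fst ` set c \<and>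
        (degree G vi)\<^sup>2 + (degree G vj)\<^sup>2 = (degree G vk)\<^sup>2)"

end

theory Submission
  imports Defs
begin

text \<open>A vertex with subset \<open>X\<close> has degree \<open>2 ^ n - 2 ^ (n - card X) - 1\<close>. Hence the degree is odd
  unless \<open>X = A\<close>, in which case it is even and strictly larger than all other degrees. If
  \<open>a\<^sup>2 + b\<^sup>2 = c\<^sup>2\<close> for the degrees of three distinct vertices, then by parity exactly one of them
  is even, the one belonging to \<open>A\<close>. It is not \<open>a\<close> or \<open>b\<close>, being the largest, and it is not
  \<open>c\<close>, since a sum of two odd squares is \<open>2\<close> modulo \<open>4\<close>.\<close>

lemma sum_odd_squares_not_square:
  fixes a b c :: nat
  assumes "odd a" "odd b"
  shows "a\<^sup>2 + b\<^sup>2 \<noteq> c\<^sup>2"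
proof
  assume eq: "a\<^sup>2 + b\<^sup>2 = c\<^sup>2"
  have odd_sq: "x\<^sup>2 mod 4 = 1" if x: "odd x" for x :: nat
  proof -
    obtain k where "x = 2 * k + 1" using x by (rule oddE)
    then have "x\<^sup>2 = 4 * (k * k + k) + 1"
      by (simp add: power2_eq_square algebra_simps)
    then show ?thesis by simp
  qed
  have "(a\<^sup>2 + b\<^sup>2) mod 4 = 2"
    using odd_sq[OF assms(1)] odd_sq[OF assms(2)] by (simp add: mod_add_eq[symmetric])
  \<comment> \<open>Parity makes \<open>c\<close> even, so its square is 0 modulo 4 and cannot match
    the residue 2.\<close>
  moreover have "even c"
    using arg_cong[OF eq, of even] assms by simp
  then obtain k where "c = 2 * k" by (rule evenE)
  then have "c\<^sup>2 mod 4 = 0" by (simp add: power2_eq_square)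
  ultimately show False using eq by simp
qed

text \<open>A subset of \<open>A\<close> either meets \<open>X\<close> or lies in
  \<open>A - X\<close>; the summand 1 accounts for \<open>X\<close> itself. The additive form avoids
  truncated subtraction.\<close>

lemma card_subsets_meeting:
  assumes "finite A" "X \<subseteq> A" "X \<noteq> {}"
  shows "card {Y. Y \<subseteq> A \<and> Y \<noteq> X \<and> X \<inter> Y \<noteq> {}} + 1 + 2 ^ card (A - X) = 2 ^ card A"
proof -
  let ?M = "{Y. Y \<subseteq> A \<and> Y \<noteq> X \<and> X \<inter> Y \<noteq> {}}"
  have "Pow A = insert X ?M \<union> Pow (A - X)" "insert X ?M \<inter> Pow (A - X) = {}"
    using assms by auto
  moreover have "finite ?M" "finite (Pow (A - X))"
    using assms(1) by (auto intro: finite_subset[of _ "Pow A"])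
  ultimately have "card (Pow A) = card ?M + 1 + card (Pow (A - X))"
    by (simp add: card_Un_disjoint)
  then show ?thesis using assms(1) by (simp add: card_Pow)
qed

text \<open>\<open>S\<close> carries the neighbours of \<open>v\<close> bijectively onto the sets
  counted in \<open>card_subsets_meeting\<close>.\<close>

lemma degree_set_graph:
  assumes "finite A" and G: "pair_graph G"
    and S: "bij_betw S (pverts G) {X. X \<subseteq> A \<and> X \<noteq> {}}"
    and adj: "\<forall>u \<in> pverts G. \<forall>v \<in> pverts G.
      (u, v) \<in> parcs G \<longleftrightarrow> u \<noteq> v \<and> S u \<inter> S v \<noteq> {}"
    and v: "v \<in> pverts G"
  shows "degree G v + 1 + 2 ^ card (A - S v) = 2 ^ card A"
proof -
  interpret pair_graph G by (rule G)
  let ?N = "{w \<in> pverts G. v \<noteq> w \<and> S v \<inter> S w \<noteq> {}}"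
  have "out_arcs (with_proj G) v = {e \<in> parcs G. fst e = v}"
    by (simp add: out_arcs_def)
  also have "\<dots> = Pair v ` {w. (v, w) \<in> parcs G}"
    by force
  also have "{w. (v, w) \<in> parcs G} = ?N"
    using adj v in_arcsD2 by blast
  finally have deg: "degree G v = card ?N"
    by (simp add: degree_def out_degree_def card_image inj_on_def)
  have "bij_betw S ?N {Y. Y \<subseteq> A \<and> Y \<noteq> S v \<and> S v \<inter> Y \<noteq> {}}"
  proof (rule bij_betw_imageI)
    show "inj_on S ?N"
      using S by (auto simp: bij_betw_def inj_on_def)
    show "S ` ?N = {Y. Y \<subseteq> A \<and> Y \<noteq> S v \<and> S v \<inter> Y \<noteq> {}}" (is "_ = ?M")
    proof
      show "S ` ?N \<subseteq> ?M"
        using S v by (auto simp: bij_betw_def inj_on_def)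
      show "?M \<subseteq> S ` ?N"
      proof
        fix Y assume Y: "Y \<in> ?M"
        then have "Y \<in> S ` pverts G" using S by (auto simp: bij_betw_def)
        with Y show "Y \<in> S ` ?N" by auto
      qed
    qed
  qed
  note deg [unfolded bij_betw_same_card[OF this]]
  moreover have "S v \<subseteq> A" "S v \<noteq> {}" using S v by (auto simp: bij_betw_def)
  ultimately show ?thesis
    using card_subsets_meeting[OF assms(1)] by simp
qed

lemma primitive_hole_verts:
  assumes "pair_graph G" "primitive_hole G c"
  shows "fst ` set c \<subseteq> pverts G"
proof -
  interpret pair_graph G by (rule assms(1))
  have "set c \<subseteq> parcs G"
    using assms(2) by (auto simp: primitive_hole_def cycle_def awalk_def)
  then show ?thesis using in_arcsD1 by force
qed

theorem theorem3p2:
  fixes A :: "'a set" and n :: nat and G :: "'v pair_pre_digraph"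
  assumes "n \<ge> 2" and "finite A" and "card A = n"
    and "is_set_graph A G"
  shows "\<not> (\<exists>c. pythagorean_hole G c)"
proof
  assume "\<exists>c. pythagorean_hole G c"
  then obtain c x y z where c: "primitive_hole G c"
    and d: "distinct [x, y, z]" and xyz: "{x, y, z} = fst ` set c"
    and eq: "(degree G x)\<^sup>2 + (degree G y)\<^sup>2 = (degree G z)\<^sup>2"
    unfolding pythagorean_hole_def by blast
  obtain S where G: "pair_graph G"
    and S: "bij_betw S (pverts G) {X. X \<subseteq> A \<and> X \<noteq> {}}"
    and adj: "\<forall>u \<in> pverts G. \<forall>v \<in> pverts G.
      (u, v) \<in> parcs G \<longleftrightarrow> u \<noteq> v \<and> S u \<inter> S v \<noteq> {}"
    using assms(4) unfolding is_set_graph_def by blast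
  have V: "x \<in> pverts G" "y \<in> pverts G" "z \<in> pverts G"
    using primitive_hole_verts[OF G c] unfolding xyz[symmetric] by simp_all
  note deg = degree_set_graph[OF assms(2) G S adj]
  have even_pow: "even ((2::nat) ^ card A)" using assms(1,3) by simp
  \<comment> \<open>For proper \<open>S v\<close> both powers of 2 in the degree formula have
    positive exponent, so \<open>degree G v + 1\<close> is even.\<close>
  have odd_deg: "odd (degree G v)" if "v \<in> pverts G" "S v \<noteq> A" for v
  proof -
    have "S v \<subseteq> A" using S that(1) by (auto simp: bij_betw_def)
    then have "A - S v \<noteq> {}" using that(2) by auto
    then have "card (A - S v) > 0" using assms(2) by (simp only: card_gt_0_iff finite_Diff simp_thms)
    then have "even ((2::nat) ^ card (A - S v))" by simp
    then show ?thesis using even_pow arg_cong[OF deg[OF that(1)], of even] by simp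
  qed
  \<comment> \<open>At \<open>S v = A\<close> the subtracted power is \<open>2 ^ 0\<close>, its
    least possible value. A weak inequality suffices: equality would force the other leg to be 0,
    which is not odd.\<close>
  have le: "degree G w \<le> degree G v" if "v \<in> pverts G" "S v = A" "w \<in> pverts G" for v w
  proof -
    have "(1::nat) \<le> 2 ^ card (A - S w)" by (rule one_le_power) simp
    moreover have "degree G v + 1 + 1 = 2 ^ card A" using deg[OF that(1)] that(2) by simp
    ultimately show ?thesis using deg[OF that(3)] by linarith
  qed
  have not_leg: False
    if "u \<in> pverts G" "w \<in> pverts G" "S u = A" "S w \<noteq> A"
      "(degree G u)\<^sup>2 + (degree G w)\<^sup>2 = (degree G z)\<^sup>2" for u w
  proof -
    have "(degree G z)\<^sup>2 \<le> (degree G u)\<^sup>2"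
      using le[OF that(1,3) V(3)] by (rule power_mono) simp
    then have "(degree G w)\<^sup>2 = 0" using that(5) by linarith
    then show False using odd_deg[OF that(2,4)] by simp
  qed
  \<comment> \<open>By injectivity at most one leg belongs to \<open>A\<close>. If neither does,
    both legs are odd, and this is impossible whichever subset \<open>z\<close> has.\<close>
  have "S x \<noteq> S y"
    using S V d by (auto simp: bij_betw_def inj_on_def)
  then consider "S x = A" "S y \<noteq> A" | "S y = A" "S x \<noteq> A" | "S x \<noteq> A" "S y \<noteq> A" by auto
  then show False
  proof cases
    case 1
    show False by (rule not_leg[OF V(1,2) 1 eq])
  next
    case 2
    then show False using not_leg[OF V(2,1) 2] eq by (simp add: add.commute)
  next
    case 3
    then show False using sum_odd_squares_not_square odd_deg V eq by blast
  qed
qed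

end
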